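(* Let $n\ge 2$, let $a,b>0$, and let $\alpha,\beta$ be nonnegative functions on $(0,\max\{a,b\}]$ such that $t\mapsto t\frac{\alpha(t)}{\beta(t)}$ is increasing on $(0,\max\{a,b\}]$ and all the integrals below are defined. Then $$\int_0^a t^{n-1}\alpha(t)\,dt-a\frac{\alpha(a)}{\beta(a)}\int_0^a t^{n-2}\beta(t)\,dt\le\int_0^b t^{n-1}\alpha(t)\,dt-a\frac{\alpha(a)}{\beta(a)}\int_0^b t^{n-2}\beta(t)\,dt.$$
   Context: "Increasing" is in the non-strict sense. The quotient $\alpha/\beta$ is assumed to be defined, i.e. $\beta(t)>0$ on $(0,\max\{a,b\}]$; "the integrals are defined" means they exist and are finite. Both cases $a\le b$ and $a>b$ are allowed. *)

theory Defs
  imports "HOL-Analysis.Analysis"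
begin

end

theory Submission
  imports Defs
begin

text \<open>
  With \<open>c = a \<alpha>(a) / \<beta>(a)\<close>, the combined integrand
  \<open>F(t) = t\<^sup>n\<^sup>-\<^sup>1 \<alpha>(t) - c t\<^sup>n\<^sup>-\<^sup>2 \<beta>(t) = t\<^sup>n\<^sup>-\<^sup>2 \<beta>(t) (t \<alpha>(t) / \<beta>(t) - c)\<close>
  is nonpositive on \<open>(0, a]\<close> and nonnegative on \<open>[a, b]\<close> by monotonicity.
  Hence \<open>1\<^bsub>(0,a]\<^esub> F \<le> 1\<^bsub>(0,b]\<^esub> F\<close> pointwise, whether or not \<open>a \<le> b\<close>.
\<close>

theorem lemma1:
  fixes n :: nat and a b :: real and \<alpha> \<beta> :: "real \<Rightarrow> real"
  assumes "n \<ge> 2"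
    and "a > 0" and "b > 0"
    and "\<And>t. t \<in> {0<..max a b} \<Longrightarrow> \<alpha> t \<ge> 0"
    and "\<And>t. t \<in> {0<..max a b} \<Longrightarrow> \<beta> t > 0"
    and "mono_on {0<..max a b} (\<lambda>t. t * (\<alpha> t / \<beta> t))"
    and "set_integrable lebesgue {0<..a} (\<lambda>t. t ^ (n - 1) * \<alpha> t)"
    and "set_integrable lebesgue {0<..a} (\<lambda>t. t ^ (n - 2) * \<beta> t)"
    and "set_integrable lebesgue {0<..b} (\<lambda>t. t ^ (n - 1) * \<alpha> t)"
    and "set_integrable lebesgue {0<..b} (\<lambda>t. t ^ (n - 2) * \<beta> t)"
  shows "(LINT t:{0<..a}|lebesgue. t ^ (n - 1) * \<alpha> t)
           - a * (\<alpha> a / \<beta> a) * (LINT t:{0<..a}|lebesgue. t ^ (n - 2) * \<beta> t)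
         \<le> (LINT t:{0<..b}|lebesgue. t ^ (n - 1) * \<alpha> t)
           - a * (\<alpha> a / \<beta> a) * (LINT t:{0<..b}|lebesgue. t ^ (n - 2) * \<beta> t)"
proof -
  define c where "c = a * (\<alpha> a / \<beta> a)"
  define F where "F t = t ^ (n - 1) * \<alpha> t - c * (t ^ (n - 2) * \<beta> t)" for t
  have F_eq: "F t = t ^ (n - 2) * \<beta> t * (t * (\<alpha> t / \<beta> t) - c)" if "t \<in> {0<..max a b}" for t
  proof -
    have "t ^ (n - 1) = t * t ^ (n - 2)"
      using Suc_diff_le[OF \<open>n \<ge> 2\<close>] by (simp flip: power_Suc)
    then show ?thesis
      using assms(5)[OF that] by (simp add: F_def field_simps)
  qed
  have F_nonpos: "F t \<le> 0" if "0 < t" "t \<le> a" for t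
  proof -
    have "t * (\<alpha> t / \<beta> t) \<le> c"
      unfolding c_def using mono_onD[OF assms(6), of t a] that by auto
    then show ?thesis
      using that by (subst F_eq) (auto intro!: mult_nonneg_nonpos mult_nonneg_nonneg less_imp_le[OF assms(5)])
  qed
  have F_nonneg: "F t \<ge> 0" if "a \<le> t" "t \<le> b" for t
  proof -
    have "c \<le> t * (\<alpha> t / \<beta> t)"
      unfolding c_def using mono_onD[OF assms(6), of a t] that \<open>a > 0\<close> by auto
    then show ?thesis
      using that \<open>a > 0\<close> by (subst F_eq) (auto intro!: mult_nonneg_nonneg less_imp_le[OF assms(5)])
  qed
  have integrable: "set_integrable lebesgue {0<..x} F"
    and integral: "(LINT t:{0<..x}|lebesgue. F t) = (LINT t:{0<..x}|lebesgue. t ^ (n - 1) * \<alpha> t)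
        - c * (LINT t:{0<..x}|lebesgue. t ^ (n - 2) * \<beta> t)" if "x \<in> {a, b}" for x
  proof -
    have *: "set_integrable lebesgue {0<..x} (\<lambda>t. t ^ (n - 1) * \<alpha> t)"
      "set_integrable lebesgue {0<..x} (\<lambda>t. c * (t ^ (n - 2) * \<beta> t))"
      using that assms(7-10) by (auto intro!: set_integrable_mult_right)
    show "set_integrable lebesgue {0<..x} F"
      unfolding F_def by (rule set_integral_diff(1)[OF *])
    show "(LINT t:{0<..x}|lebesgue. F t) = (LINT t:{0<..x}|lebesgue. t ^ (n - 1) * \<alpha> t)
        - c * (LINT t:{0<..x}|lebesgue. t ^ (n - 2) * \<beta> t)"
      unfolding F_def by (simp only: set_integral_diff(2)[OF *] set_integral_mult_right)
  qed
  have "(LINT t:{0<..a}|lebesgue. F t) \<le> (LINT t:{0<..b}|lebesgue. F t)"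
    unfolding set_lebesgue_integral_def
  proof (rule integral_mono)
    show "indicator {0<..a} t *\<^sub>R F t \<le> indicator {0<..b} t *\<^sub>R F t" for t
      using F_nonpos[of t] F_nonneg[of t] by (auto simp: indicator_def)
  qed (use integrable in \<open>auto simp: set_integrable_def\<close>)
  then show ?thesis
    by (simp add: integral c_def)
qed

end
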